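(* Let $K\subseteq F$ be an extension of fields of characteristic $p>0$, and regard $F$ as a right $K[t;Frob]$-module via $x.\left(\sum_i t^ia_i\right)=\sum_i a_ix^{p^i}$. Then the torsion submodule $F_{tor}$ of $F$ equals the algebraic closure of $K$ in $F$. Moreover, two $p$-closed algebraic field extensions $F_1$ and $F_2$ of $K$ are elementarily equivalent as $K[t;Frob]$-modules (in the language $L_{Mod}(K[t;Frob])$) if and only if they are isomorphic as $K[t;Frob]$-modules.
   Context: $Frob$ is the Frobenius endomorphism $x\mapsto x^p$ of $K$; $K[t;Frob]$ is the ring of finite sums $\sum_it^ia_i$ ($a_i\in K$) with termwise addition and multiplication determined by $at=ta^p$. For a module $M$, $M_{tor}=\{x: x.r=0$ for some non-zero $r\}$. A field $L$ of characteristic $p$ is $p$-closed if every polynomial of the form $X^{p^n}+a_{n-1}X^{p^{n-1}}+\dots+a_1X^p+a_0X+b\in L[X]$ has a root in $L$. *)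

theory Defs
  imports "HOL-Computational_Algebra.Computational_Algebra"
begin

section \<open>The skew polynomial ring $K[t;Frob]$\<close>

text \<open>
  An element $\sum_i t^i a_i$, with coefficients written on the right of the powers of $t$,
  is represented by the sequence $(a_i)$ of its coefficients, stored as an ordinary polynomial.
  Addition is inherited, but the multiplication is the one determined by $a t = t a^p$,
  that is, $(t^i a)(t^j b) = t^{i+j} a^{p^j} b$.
\<close>

typedef (overloaded) 'a skew_poly = "UNIV :: 'a::zero poly set"
  morphisms poly_of_skew skew_of_poly ..

setup_lifting type_definition_skew_poly

lift_definition skew_coeff :: "'a::zero skew_poly \<Rightarrow> nat \<Rightarrow> 'a" is coeff .

lift_definition skew_degree :: "'a::zero skew_poly \<Rightarrow> nat" is degree .

text \<open>\<open>skew_monom i a\<close> is $t^i a$.\<close>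

lift_definition skew_monom :: "nat \<Rightarrow> 'a::zero \<Rightarrow> 'a skew_poly" is "\<lambda>i a. monom a i" .

definition skew_mult :: "'a::field_prime_char poly \<Rightarrow> 'a poly \<Rightarrow> 'a poly" where
  "skew_mult f g =
     (\<Sum>i\<le>degree f. \<Sum>j\<le>degree g. monom (coeff f i ^ (CHAR('a) ^ j) * coeff g j) (i + j))"

lemma frob_pow_add: "(x + y :: 'a::field_prime_char) ^ (CHAR('a) ^ n) = x ^ (CHAR('a) ^ n) + y ^ (CHAR('a) ^ n)"
  by (rule freshmans_dream') auto

lemma skew_mult_bound:
  fixes f g :: "'a::field_prime_char poly"
  assumes "degree f \<le> N" "degree g \<le> M"
  shows "skew_mult f g =
     (\<Sum>i\<le>N. \<Sum>j\<le>M. monom (coeff f i ^ (CHAR('a) ^ j) * coeff g j) (i + j))"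
proof -
  have "skew_mult f g =
     (\<Sum>i\<le>degree f. \<Sum>j\<le>M. monom (coeff f i ^ (CHAR('a) ^ j) * coeff g j) (i + j))"
    unfolding skew_mult_def using assms
    by (intro sum.cong refl sum.mono_neutral_left) (auto simp: coeff_eq_0)
  also have "\<dots> = (\<Sum>i\<le>N. \<Sum>j\<le>M. monom (coeff f i ^ (CHAR('a) ^ j) * coeff g j) (i + j))"
    using assms by (intro sum.mono_neutral_left) (auto simp: coeff_eq_0 power_0_left)
  finally show ?thesis .
qed

lemma skew_mult_add_left: "skew_mult (f + g) h = skew_mult f h + skew_mult g h"
proof -
  define N where "N = max (degree f) (degree g)"
  have "degree f \<le> N" "degree g \<le> N" "degree (f + g) \<le> N"
    by (auto simp: N_def degree_add_le_max)
  then show ?thesis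
    by (simp add: skew_mult_bound[of _ N h "degree h"] frob_pow_add distrib_right
        add_monom[symmetric] sum.distrib)
qed

lemma skew_mult_add_right: "skew_mult h (f + g) = skew_mult h f + skew_mult h g"
proof -
  define N where "N = max (degree f) (degree g)"
  have "degree f \<le> N" "degree g \<le> N" "degree (f + g) \<le> N"
    by (auto simp: N_def degree_add_le_max)
  then show ?thesis
    by (simp add: skew_mult_bound[of h "degree h" _ N] distrib_left
        add_monom[symmetric] sum.distrib)
qed

lemma skew_mult_monom:
  "skew_mult (monom a i) (monom (b :: 'a::field_prime_char) j) = monom (a ^ (CHAR('a) ^ j) * b) (i + j)"
proof -
  let ?c = "\<lambda>k l. monom (coeff (monom a i) k ^ (CHAR('a) ^ l) * coeff (monom b j) l) (k + l)"
  have "skew_mult (monom a i) (monom b j) = (\<Sum>k\<le>i. \<Sum>l\<le>j. ?c k l)"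
    by (rule skew_mult_bound) (simp_all add: degree_monom_le)
  also have "\<dots> = (\<Sum>k\<in>{i}. \<Sum>l\<le>j. ?c k l)"
    by (rule sum.mono_neutral_right) (auto simp: power_0_left)
  also have "\<dots> = (\<Sum>l\<le>j. ?c i l)" by simp
  also have "\<dots> = (\<Sum>l\<in>{j}. ?c i l)"
    by (rule sum.mono_neutral_right) auto
  finally show ?thesis by simp
qed

lemma poly_monom_induct [case_names monom add]:
  fixes f :: "'a::comm_monoid_add poly"
  assumes "\<And>a i. P (monom a i)" and "\<And>f g. P f \<Longrightarrow> P g \<Longrightarrow> P (f + g)"
  shows "P f"
proof -
  have "P (\<Sum>i\<in>A. monom (coeff f i) i)" if "finite A" for A
    using that by induction (use assms(1)[of 0 0] in \<open>auto intro: assms\<close>)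
  from this[of "{..degree f}"] show ?thesis by (simp add: poly_as_sum_of_monoms)
qed

lemma skew_mult_assoc:
  fixes f g h :: "'a::field_prime_char poly"
  shows "skew_mult (skew_mult f g) h = skew_mult f (skew_mult g h)"
proof (induction f rule: poly_monom_induct)
  case (monom a i)
  show ?case
  proof (induction g rule: poly_monom_induct)
    case (monom b j)
    show ?case
    proof (induction h rule: poly_monom_induct)
      case (monom c k)
      show ?case
        by (simp add: skew_mult_monom power_mult_distrib power_add add_ac mult_ac flip: power_mult)
    qed (simp add: skew_mult_add_right)
  qed (simp add: skew_mult_add_right skew_mult_add_left)
qed (simp add: skew_mult_add_left)

instantiation skew_poly :: (field_prime_char) ring_1
begin

lift_definition zero_skew_poly :: "'a skew_poly" is 0 .
lift_definition one_skew_poly :: "'a skew_poly" is 1 .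
lift_definition plus_skew_poly :: "'a skew_poly \<Rightarrow> 'a skew_poly \<Rightarrow> 'a skew_poly" is "(+)" .
lift_definition minus_skew_poly :: "'a skew_poly \<Rightarrow> 'a skew_poly \<Rightarrow> 'a skew_poly" is "(-)" .
lift_definition uminus_skew_poly :: "'a skew_poly \<Rightarrow> 'a skew_poly" is uminus .
lift_definition times_skew_poly :: "'a skew_poly \<Rightarrow> 'a skew_poly \<Rightarrow> 'a skew_poly" is skew_mult .

instance
proof
  fix f g h :: "'a skew_poly"
  show "f * g * h = f * (g * h)" by transfer (rule skew_mult_assoc)
  show "(f + g) * h = f * h + g * h" by transfer (rule skew_mult_add_left)
  show "f * (g + h) = f * g + f * h" by transfer (rule skew_mult_add_right)
  show "1 * f = f"
  proof transfer
    fix f :: "'a poly"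
    show "skew_mult 1 f = f"
      by (induction f rule: poly_monom_induct)
        (simp_all add: skew_mult_add_right skew_mult_monom flip: monom_eq_1)
  qed
  show "f * 1 = f"
  proof transfer
    fix f :: "'a poly"
    show "skew_mult f 1 = f"
      by (induction f rule: poly_monom_induct)
        (simp_all add: skew_mult_add_left skew_mult_monom flip: monom_eq_1)
  qed
  show "(0 :: 'a skew_poly) \<noteq> 1" by transfer simp
qed (transfer; simp)+

end

lemma skew_monom_mult:
  "skew_monom i a * skew_monom j (b :: 'a::field_prime_char) =
     skew_monom (i + j) (a ^ (CHAR('a) ^ j) * b)"
  by transfer (rule skew_mult_monom)

lemma skew_commutation:
  "skew_monom 0 (a :: 'a::field_prime_char) * skew_monom 1 1 = skew_monom 1 1 * skew_monom 0 (a ^ CHAR('a))"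
  by (simp add: skew_monom_mult)


section \<open>Right modules\<close>

locale right_module =
  fixes act :: "'m::ab_group_add \<Rightarrow> 'r::ring_1 \<Rightarrow> 'm"
  assumes act_add_left: "act (x + y) r = act x r + act y r"
    and act_add_right: "act x (r + s) = act x r + act x s"
    and act_mult: "act x (r * s) = act (act x r) s"
    and act_one: "act x 1 = x"

definition torsion :: "('m::ab_group_add \<Rightarrow> 'r::ring_1 \<Rightarrow> 'm) \<Rightarrow> 'm set" where
  "torsion act = {x. \<exists>r. r \<noteq> 0 \<and> act x r = 0}"

definition module_iso ::
  "('m::ab_group_add \<Rightarrow> 'r::ring_1 \<Rightarrow> 'm) \<Rightarrow> ('n::ab_group_add \<Rightarrow> 'r \<Rightarrow> 'n) \<Rightarrow> ('m \<Rightarrow> 'n) \<Rightarrow> bool" where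
  "module_iso act1 act2 h \<longleftrightarrow>
     bij h \<and> (\<forall>x y. h (x + y) = h x + h y) \<and> (\<forall>x r. h (act1 x r) = act2 (h x) r)"

definition modules_isomorphic ::
  "('m::ab_group_add \<Rightarrow> 'r::ring_1 \<Rightarrow> 'm) \<Rightarrow> ('n::ab_group_add \<Rightarrow> 'r \<Rightarrow> 'n) \<Rightarrow> bool" where
  "modules_isomorphic act1 act2 \<longleftrightarrow> (\<exists>h. module_iso act1 act2 h)"


section \<open>The first-order language $L_{Mod}(R)$\<close>

text \<open>
  The language of abelian groups $\{0,+,-\}$ together with a unary function symbol for each
  element of $R$. Variables are named by natural numbers.
\<close>

datatype 'r mod_term =
    TVar nat
  | TZero
  | TPlus "'r mod_term" "'r mod_term"
  | TMinus "'r mod_term"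
  | TAct "'r mod_term" 'r

datatype 'r mod_form =
    FEq "'r mod_term" "'r mod_term"
  | FNot "'r mod_form"
  | FAnd "'r mod_form" "'r mod_form"
  | FEx nat "'r mod_form"

primrec term_vars :: "'r mod_term \<Rightarrow> nat set" where
  "term_vars (TVar n) = {n}"
| "term_vars TZero = {}"
| "term_vars (TPlus s t) = term_vars s \<union> term_vars t"
| "term_vars (TMinus t) = term_vars t"
| "term_vars (TAct t r) = term_vars t"

primrec free_vars :: "'r mod_form \<Rightarrow> nat set" where
  "free_vars (FEq s t) = term_vars s \<union> term_vars t"
| "free_vars (FNot \<phi>) = free_vars \<phi>"
| "free_vars (FAnd \<phi> \<psi>) = free_vars \<phi> \<union> free_vars \<psi>"
| "free_vars (FEx n \<phi>) = free_vars \<phi> - {n}"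

definition sentence :: "'r mod_form \<Rightarrow> bool" where
  "sentence \<phi> \<longleftrightarrow> free_vars \<phi> = {}"

primrec term_val ::
  "('m::ab_group_add \<Rightarrow> 'r \<Rightarrow> 'm) \<Rightarrow> (nat \<Rightarrow> 'm) \<Rightarrow> 'r mod_term \<Rightarrow> 'm" where
  "term_val act e (TVar n) = e n"
| "term_val act e TZero = 0"
| "term_val act e (TPlus s t) = term_val act e s + term_val act e t"
| "term_val act e (TMinus t) = - term_val act e t"
| "term_val act e (TAct t r) = act (term_val act e t) r"

primrec sat ::
  "('m::ab_group_add \<Rightarrow> 'r \<Rightarrow> 'm) \<Rightarrow> (nat \<Rightarrow> 'm) \<Rightarrow> 'r mod_form \<Rightarrow> bool" where
  "sat act e (FEq s t) \<longleftrightarrow> term_val act e s = term_val act e t"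
| "sat act e (FNot \<phi>) \<longleftrightarrow> \<not> sat act e \<phi>"
| "sat act e (FAnd \<phi> \<psi>) \<longleftrightarrow> sat act e \<phi> \<and> sat act e \<psi>"
| "sat act e (FEx n \<phi>) \<longleftrightarrow> (\<exists>x. sat act (e(n := x)) \<phi>)"

definition models :: "('m::ab_group_add \<Rightarrow> 'r \<Rightarrow> 'm) \<Rightarrow> 'r mod_form \<Rightarrow> bool" where
  "models act \<phi> \<longleftrightarrow> (\<forall>e. sat act e \<phi>)"

definition elementarily_equivalent ::
  "('m::ab_group_add \<Rightarrow> 'r \<Rightarrow> 'm) \<Rightarrow> ('n::ab_group_add \<Rightarrow> 'r \<Rightarrow> 'n) \<Rightarrow> bool" where
  "elementarily_equivalent act1 act2 \<longleftrightarrow>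
     (\<forall>\<phi>. sentence \<phi> \<longrightarrow> (models act1 \<phi> \<longleftrightarrow> models act2 \<phi>))"


section \<open>Field extensions\<close>

text \<open>
  An extension $K \subseteq F$ is given by the embedding of $K$ into $F$; injectivity is
  automatic. The characteristic \<open>p\<close> is \<open>CHAR('k)\<close>, which agrees with \<open>CHAR('f)\<close>.
\<close>

locale field_extension =
  fixes emb :: "'k::field \<Rightarrow> 'f::field"
  assumes emb_add: "emb (a + b) = emb a + emb b"
    and emb_mult: "emb (a * b) = emb a * emb b"
    and emb_one: "emb 1 = 1"
begin

lemma emb_zero [simp]: "emb 0 = 0"
  using emb_add[of 0 0] by (metis add_cancel_right_right)

lemma emb_power: "emb (a ^ n) = emb a ^ n"
  by (induction n) (simp_all add: emb_one emb_mult)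

lemma emb_of_nat: "emb (of_nat n) = of_nat n"
  by (induction n) (simp_all add: emb_one emb_add)

lemma emb_eq_0_iff [simp]: "emb a = 0 \<longleftrightarrow> a = 0"
proof
  assume *: "emb a = 0"
  show "a = 0"
  proof (rule ccontr)
    assume "a \<noteq> 0"
    then have "emb 1 = emb a * emb (inverse a)" by (simp flip: emb_mult)
    with * show False by (simp add: emb_one)
  qed
qed simp

lemma emb_inj: "inj emb"
proof (rule injI)
  fix a b assume "emb a = emb b"
  moreover have "emb (a - b) + emb b = emb a" by (simp flip: emb_add)
  ultimately have "emb (a - b) = 0" by simp
  then show "a = b" by simp
qed

lemma CHAR_eq: "CHAR('f) = CHAR('k)"
proof (rule CHAR_eqI)
  show "of_nat CHAR('k) = (0 :: 'f)" using emb_of_nat[of "CHAR('k)"] by simp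
next
  fix n assume "of_nat n = (0 :: 'f)"
  then have "of_nat n = (0 :: 'k)" using emb_of_nat[of n] by simp
  then show "CHAR('k) dvd n" by (simp add: of_nat_eq_0_iff_char_dvd)
qed

end

definition algebraic_over :: "('k::field \<Rightarrow> 'f::field) \<Rightarrow> 'f \<Rightarrow> bool" where
  "algebraic_over emb x \<longleftrightarrow> (\<exists>q. q \<noteq> 0 \<and> poly (map_poly emb q) x = 0)"

definition algebraic_closure_in :: "('k::field \<Rightarrow> 'f::field) \<Rightarrow> 'f set" where
  "algebraic_closure_in emb = {x. algebraic_over emb x}"

definition algebraic_extension :: "('k::field \<Rightarrow> 'f::field) \<Rightarrow> bool" where
  "algebraic_extension emb \<longleftrightarrow> field_extension emb \<and> (\<forall>x. algebraic_over emb x)"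

definition p_closed :: "'l::field_prime_char itself \<Rightarrow> bool" where
  "p_closed _ \<longleftrightarrow>
     (\<forall>n (a :: nat \<Rightarrow> 'l) b.
        \<exists>x. poly (monom 1 (CHAR('l) ^ n) + (\<Sum>i<n. monom (a i) (CHAR('l) ^ i)) + [:b:]) x = 0)"


section \<open>$F$ as a right $K[t;Frob]$-module\<close>

definition frob_act ::
  "('k::field_prime_char \<Rightarrow> 'f::field_prime_char) \<Rightarrow> 'f \<Rightarrow> 'k skew_poly \<Rightarrow> 'f" where
  "frob_act emb x r = (\<Sum>i\<le>skew_degree r. emb (skew_coeff r i) * x ^ (CHAR('k) ^ i))"

lemma frob_act_right_module:
  fixes emb :: "'k::field_prime_char \<Rightarrow> 'f::field_prime_char"
  assumes "field_extension emb"
  shows "right_module (frob_act emb)"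
proof -
  interpret field_extension emb by fact
  define A where "A x f = (\<Sum>i\<le>degree f. emb (coeff f i) * x ^ (CHAR('k) ^ i))" for x f
  have A_bound: "A x f = (\<Sum>i\<le>N. emb (coeff f i) * x ^ (CHAR('k) ^ i))" if "degree f \<le> N" for x f N
    unfolding A_def using that by (intro sum.mono_neutral_left) (auto simp: coeff_eq_0)
  have frob: "(x + y) ^ (CHAR('k) ^ i) = x ^ (CHAR('k) ^ i) + y ^ (CHAR('k) ^ i)" for x y :: 'f and i
    using frob_pow_add[of x y i] by (simp add: CHAR_eq)
  have A_left: "A (x + y) f = A x f + A y f" for x y f
    by (simp add: A_def frob distrib_left sum.distrib)
  have A_right: "A x (f + g) = A x f + A x g" for x f g
  proof -
    define N where "N = max (degree f) (degree g)"
    have "degree f \<le> N" "degree g \<le> N" "degree (f + g) \<le> N"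
      by (auto simp: N_def degree_add_le_max)
    then show ?thesis by (simp add: A_bound[of _ N] emb_add distrib_right sum.distrib)
  qed
  have A_monom: "A x (monom a i) = emb a * x ^ (CHAR('k) ^ i)" for x a i
  proof -
    have "A x (monom a i) = (\<Sum>j\<le>i. emb (coeff (monom a i) j) * x ^ (CHAR('k) ^ j))"
      by (rule A_bound) (rule degree_monom_le)
    also have "\<dots> = (\<Sum>j\<in>{i}. emb (coeff (monom a i) j) * x ^ (CHAR('k) ^ j))"
      by (rule sum.mono_neutral_right) auto
    finally show ?thesis by simp
  qed
  have A_mult: "A x (skew_mult f g) = A (A x f) g" for x f g
  proof (induction f arbitrary: x rule: poly_monom_induct)
    case (monom a i)
    show ?case
      by (induction g rule: poly_monom_induct)
        (simp_all add: skew_mult_monom skew_mult_add_right A_right A_monom emb_mult emb_power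
          power_mult_distrib power_add mult_ac flip: power_mult)
  next
    case (add f g)
    then show ?case by (simp add: skew_mult_add_left A_left A_right)
  qed
  have A_eq: "frob_act emb x r = A x (poly_of_skew r)" for x r
    by (simp add: frob_act_def A_def skew_degree.rep_eq skew_coeff.rep_eq)
  show ?thesis
  proof
    show "frob_act emb x 1 = x" for x
      using A_monom[of x 1 0] by (simp add: A_eq one_skew_poly.rep_eq emb_one)
  qed (simp_all add: A_eq plus_skew_poly.rep_eq times_skew_poly.rep_eq A_left A_right A_mult)
qed

end

theory Submission
  imports Defs "HOL-Analysis.Function_Topology"
begin

text \<open>
  If \<open>x\<close> is a root of \<open>q \<noteq> 0\<close>, then the residues of \<open>X\<^bsup>p^i\<^esup>\<close> modulo \<open>q\<close> are linearly dependent,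
  which yields a non-zero additive polynomial killing \<open>x\<close>; hence torsion means algebraic.

  A non-zero additive polynomial has finitely many roots, so an algebraic extension is a torsion
  module in which every non-zero ring element has a finite annihilator. For such modules,
  elementary equivalence lifts every finite part of the diagram of the first module to the second,
  and Tychonoff's theorem on the product of the finite annihilators glues these finite pieces to an
  embedding. It is onto because elementary equivalence also equates the sizes of the annihilators.
\<close>

section \<open>Elementary equivalence and isomorphism\<close>

lemma term_val_cong:
  "(\<And>n. n \<in> term_vars t \<Longrightarrow> e n = e' n) \<Longrightarrow> term_val act e t = term_val act e' t"
  by (induction t) auto

lemma sat_cong:
  "(\<And>n. n \<in> free_vars \<phi> \<Longrightarrow> e n = e' n) \<Longrightarrow> sat act e \<phi> \<longleftrightarrow> sat act e' \<phi>"
proof (induction \<phi> arbitrary: e e')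
  case (FEq s t)
  then show ?case using term_val_cong[of s e e' act] term_val_cong[of t e e' act] by simp
next
  case (FNot \<phi>)
  from FNot.prems have "sat act e \<phi> \<longleftrightarrow> sat act e' \<phi>" by (auto intro!: FNot.IH)
  then show ?case by simp
next
  case (FAnd \<phi> \<psi>)
  from FAnd.prems have "sat act e \<phi> \<longleftrightarrow> sat act e' \<phi>" "sat act e \<psi> \<longleftrightarrow> sat act e' \<psi>"
    by (auto intro!: FAnd.IH)
  then show ?case by simp
next
  case (FEx n \<phi>)
  have "sat act (e(n := x)) \<phi> \<longleftrightarrow> sat act (e'(n := x)) \<phi>" for x
    by (rule FEx.IH) (use FEx.prems in auto)
  then show ?case by simp
qed

lemma models_sentence_iff: "sentence \<phi> \<Longrightarrow> models act \<phi> \<longleftrightarrow> sat act e \<phi>"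
  unfolding models_def sentence_def using sat_cong by blast

lemma finite_term_vars: "finite (term_vars t)"
  by (induction t) auto

lemma finite_free_vars: "finite (free_vars \<phi>)"
  by (induction \<phi>) (auto simp: finite_term_vars)

lemma sat_foldr_FAnd:
  "sat act e (foldr FAnd \<phi>s (FEq TZero TZero)) \<longleftrightarrow> (\<forall>\<phi>\<in>set \<phi>s. sat act e \<phi>)"
  by (induction \<phi>s) auto

lemma free_vars_foldr_FEx: "free_vars (foldr FEx ns \<phi>) = free_vars \<phi> - set ns"
  by (induction ns) auto

lemma sat_foldr_FEx_I: "sat act e \<phi> \<Longrightarrow> sat act e (foldr FEx ns \<phi>)"
proof (induction ns)
  case (Cons n ns)
  \<comment> \<open>The witness for each quantifier is the value that \<open>e\<close> already gives
    to the variable, so the assignment never changes.\<close>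
  then have "sat act (e(n := e n)) (foldr FEx ns \<phi>)" by simp
  then show ?case unfolding foldr.simps o_apply sat.simps by (rule exI)
qed simp

lemma sat_foldr_FEx_D: "sat act e (foldr FEx ns \<phi>) \<Longrightarrow> \<exists>e'. sat act e' \<phi>"
  by (induction ns arbitrary: e) auto

section \<open>Transfer between elementarily equivalent modules\<close>

lemma elementarily_equivalent_sym:
  "elementarily_equivalent act1 act2 \<Longrightarrow> elementarily_equivalent act2 act1"
  by (simp add: elementarily_equivalent_def)

text \<open>The conjunction of the finitely many formulas, closed existentially, is a sentence
  witnessed by \<open>e\<close> in the first module. It therefore holds in the second one, where its
  witnesses make up one assignment \<open>e'\<close> serving all formulas simultaneously.\<close>

lemma elementarily_equivalent_realize:
  assumes "elementarily_equivalent act1 act2" and "finite \<Phi>" and "\<And>\<phi>. \<phi> \<in> \<Phi> \<Longrightarrow> sat act1 e \<phi>"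
  shows "\<exists>e'. \<forall>\<phi>\<in>\<Phi>. sat act2 e' \<phi>"
proof -
  obtain \<phi>s where \<phi>s: "set \<phi>s = \<Phi>" using finite_list[OF assms(2)] by blast
  define \<psi> where "\<psi> = foldr FAnd \<phi>s (FEq TZero TZero)"
  obtain ns where ns: "set ns = free_vars \<psi>" using finite_list[OF finite_free_vars] by blast
  have sent: "sentence (foldr FEx ns \<psi>)" by (simp add: sentence_def free_vars_foldr_FEx ns)
  have "sat act1 e \<psi>" using assms(3) by (simp add: \<psi>_def sat_foldr_FAnd \<phi>s)
  then have "models act1 (foldr FEx ns \<psi>)"
    by (simp add: models_sentence_iff[OF sent, of _ e] sat_foldr_FEx_I)
  then have "models act2 (foldr FEx ns \<psi>)"
    using assms(1) sent by (simp add: elementarily_equivalent_def)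
  then obtain e' where "sat act2 e' \<psi>"
    unfolding models_def using sat_foldr_FEx_D by blast
  then show ?thesis by (auto simp: \<psi>_def sat_foldr_FAnd \<phi>s)
qed

section \<open>Invariance of satisfaction under isomorphism\<close>

lemma sat_module_iso:
  fixes act1 :: "'m::ab_group_add \<Rightarrow> 'r::ring_1 \<Rightarrow> 'm"
    and act2 :: "'n::ab_group_add \<Rightarrow> 'r \<Rightarrow> 'n"
  assumes "module_iso act1 act2 h"
  shows "sat act2 (h \<circ> e) \<phi> \<longleftrightarrow> sat act1 e \<phi>"
proof -
  have bij: "bij h" and add: "\<And>x y. h (x + y) = h x + h y"
    and act: "\<And>x r. h (act1 x r) = act2 (h x) r"
    using assms by (auto simp: module_iso_def)
  have zero: "h 0 = 0" using add[of 0 0] by simp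
  have minus: "h (- x) = - h x" for x
    using add[of x "- x"] zero by (simp add: eq_neg_iff_add_eq_0 add.commute)
  have val: "term_val act2 (h \<circ> e) t = h (term_val act1 e t)" for e t
    by (induction t) (simp_all add: zero minus add act)
  show ?thesis
  proof (induction \<phi> arbitrary: e)
    case (FEq s t)
    show ?case using inj_eq[OF bij_is_inj[OF bij]] by (simp only: sat.simps val)
  next
    case (FEx n \<phi>)
    \<comment> \<open>Transporting an assignment along \<open>h\<close> commutes with updating it,
      and surjectivity of \<open>h\<close> puts every possible witness in the second module into the
      form \<open>h x\<close>.\<close>
    have "(h \<circ> e)(n := h x) = h \<circ> e(n := x)" for x by auto
    then have "sat act2 ((h \<circ> e)(n := h x)) \<phi> \<longleftrightarrow> sat act1 (e(n := x)) \<phi>" for x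
      using FEx.IH by metis
    moreover have "\<exists>x. y = h x" for y using bij by (meson bij_pointE)
    ultimately show ?case unfolding sat.simps by metis
  qed auto
qed

lemma modules_isomorphic_imp_elementarily_equivalent:
  assumes "modules_isomorphic act1 act2"
  shows "elementarily_equivalent act1 act2"
proof -
  obtain h where "module_iso act1 act2 h" using assms by (auto simp: modules_isomorphic_def)
  then have "models act1 \<phi> \<longleftrightarrow> models act2 \<phi>" if "sentence \<phi>" for \<phi>
    using models_sentence_iff[OF that] sat_module_iso by metis
  then show ?thesis by (simp add: elementarily_equivalent_def)
qed


section \<open>Gluing finite partial embeddings\<close>

text \<open>\<open>S\<close> need not be a submodule: each condition is imposed only when the result
  stays in \<open>S\<close>. For finite \<open>S\<close> and \<open>A\<close> this amounts to
  finitely many quantifier-free formulas, which elementary equivalence can transfer. Preservation of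
  zero needs no clause, since it follows from 0 + 0 = 0 once 0 is in \<open>S\<close>.\<close>

definition partial_embedding ::
  "('m::ab_group_add \<Rightarrow> 'r::ring_1 \<Rightarrow> 'm) \<Rightarrow> ('n::ab_group_add \<Rightarrow> 'r \<Rightarrow> 'n) \<Rightarrow>
     'm set \<Rightarrow> 'r set \<Rightarrow> ('m \<Rightarrow> 'n) \<Rightarrow> bool" where
  "partial_embedding act1 act2 S A h \<longleftrightarrow> inj_on h S \<and>
     (\<forall>x\<in>S. \<forall>y\<in>S. x + y \<in> S \<longrightarrow> h (x + y) = h x + h y) \<and>
     (\<forall>x\<in>S. \<forall>r\<in>A. act1 x r \<in> S \<longrightarrow> h (act1 x r) = act2 (h x) r)"

lemma partial_embedding_cong:
  "(\<And>x. x \<in> S \<Longrightarrow> g x = h x) \<Longrightarrow>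
     partial_embedding act1 act2 S A g \<longleftrightarrow> partial_embedding act1 act2 S A h"
  by (simp add: partial_embedding_def cong: inj_on_cong)

lemma partial_embedding_mono:
  "partial_embedding act1 act2 S A h \<Longrightarrow> S' \<subseteq> S \<Longrightarrow> A' \<subseteq> A \<Longrightarrow>
     partial_embedding act1 act2 S' A' h"
  unfolding partial_embedding_def by (blast intro: inj_on_subset)

lemma partial_embedding_zero:
  "partial_embedding act1 act2 S A h \<Longrightarrow> 0 \<in> S \<Longrightarrow> h 0 = 0"
  unfolding partial_embedding_def by (metis add_cancel_right_right)

lemma partial_embedding_annihilator:
  "partial_embedding act1 act2 S A h \<Longrightarrow> 0 \<in> S \<Longrightarrow> x \<in> S \<Longrightarrow> r \<in> A \<Longrightarrow> act1 x r = 0 \<Longrightarrow>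
     act2 (h x) r = 0"
  using partial_embedding_zero[of act1 act2 S A h] unfolding partial_embedding_def by metis

text \<open>Naming the elements of \<open>S\<close> by variables turns the inequations, sums and
  scalar multiples inside \<open>S\<close> into a finite diagram. A realization of this diagram in
  the second module is the desired map.\<close>

lemma ex_partial_embedding:
  fixes act1 :: "'m::ab_group_add \<Rightarrow> 'r::ring_1 \<Rightarrow> 'm"
    and act2 :: "'n::ab_group_add \<Rightarrow> 'r \<Rightarrow> 'n"
  assumes ee: "elementarily_equivalent act1 act2" and fin: "finite S" "finite A"
  shows "\<exists>h. partial_embedding act1 act2 S A h"
proof -
  \<comment> \<open>\<open>c x\<close> is the variable naming \<open>x\<close>, and the assignment
    \<open>e\<close> below sends each name back to its element, so the diagram holds under
    \<open>e\<close>.\<close>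
  obtain c :: "'m \<Rightarrow> nat" where c: "inj_on c S"
    using finite_imp_inj_to_nat_seg[OF fin(1)] by blast
  define e where "e = inv_into S c"
  have e: "e (c x) = x" if "x \<in> S" for x using that c by (simp add: e_def)
  define \<Phi>1 :: "'r mod_form set"
    where "\<Phi>1 = (\<lambda>(x, y). FNot (FEq (TVar (c x)) (TVar (c y)))) ` {(x, y) \<in> S \<times> S. x \<noteq> y}"
  define \<Phi>2 :: "'r mod_form set" where
    "\<Phi>2 = (\<lambda>(x, y). FEq (TVar (c (x + y))) (TPlus (TVar (c x)) (TVar (c y)))) `
       {(x, y) \<in> S \<times> S. x + y \<in> S}"
  define \<Phi>3 where
    "\<Phi>3 = (\<lambda>(x, r). FEq (TVar (c (act1 x r))) (TAct (TVar (c x)) r)) `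
       {(x, r) \<in> S \<times> A. act1 x r \<in> S}"
  have "finite (S \<times> S)" "finite (S \<times> A)" using fin by auto
  then have "finite \<Phi>1" "finite \<Phi>2" "finite \<Phi>3"
    unfolding \<Phi>1_def \<Phi>2_def \<Phi>3_def by (auto intro!: finite_imageI elim!: rev_finite_subset)
  then have finite_diagram: "finite (\<Phi>1 \<union> \<Phi>2 \<union> \<Phi>3)" by simp
  have diagram: "sat act1 e \<phi>" if "\<phi> \<in> \<Phi>1 \<union> \<Phi>2 \<union> \<Phi>3" for \<phi>
    using that by (auto simp: \<Phi>1_def \<Phi>2_def \<Phi>3_def e)
  obtain e' where e': "\<And>\<phi>. \<phi> \<in> \<Phi>1 \<union> \<Phi>2 \<union> \<Phi>3 \<Longrightarrow> sat act2 e' \<phi>"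
    using elementarily_equivalent_realize[OF ee finite_diagram diagram] by blast
  have "e' (c x) \<noteq> e' (c y)" if "x \<in> S" "y \<in> S" "x \<noteq> y" for x y
    using that e'[of "FNot (FEq (TVar (c x)) (TVar (c y)))"] by (force simp: \<Phi>1_def)
  moreover have "e' (c (x + y)) = e' (c x) + e' (c y)" if "x \<in> S" "y \<in> S" "x + y \<in> S" for x y
    using that e'[of "FEq (TVar (c (x + y))) (TPlus (TVar (c x)) (TVar (c y)))"]
    by (force simp: \<Phi>2_def)
  moreover have "e' (c (act1 x r)) = act2 (e' (c x)) r" if "x \<in> S" "r \<in> A" "act1 x r \<in> S" for x r
    using that e'[of "FEq (TVar (c (act1 x r))) (TAct (TVar (c x)) r)"]
    by (force simp: \<Phi>3_def)
  ultimately have "partial_embedding act1 act2 S A (e' \<circ> c)"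
    by (auto simp: partial_embedding_def inj_on_def)
  then show ?thesis by blast
qed

text \<open>The product of the finite discrete spaces \<open>D x\<close> is compact by Tychonoff. A
  condition that depends on finitely many coordinates cuts out a closed set, and solvability of
  finite subsystems is the finite intersection property.\<close>

lemma compactness_finite_domains:
  fixes D :: "'a \<Rightarrow> 'b set" and P :: "'i \<Rightarrow> ('a \<Rightarrow> 'b) \<Rightarrow> bool"
  assumes fin: "\<And>x. finite (D x)"
    and local: "\<And>i. \<exists>S. finite S \<and> (\<forall>g h. (\<forall>x\<in>S. g x = h x) \<longrightarrow> P i g \<longrightarrow> P i h)"
    and sat: "\<And>I. finite I \<Longrightarrow> \<exists>h. (\<forall>x. h x \<in> D x) \<and> (\<forall>i\<in>I. P i h)"
  shows "\<exists>h. (\<forall>x. h x \<in> D x) \<and> (\<forall>i. P i h)"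
proof -
  define T where "T = product_topology (\<lambda>x. discrete_topology (D x)) UNIV"
  have top: "topspace T = {h. \<forall>x. h x \<in> D x}" by (auto simp: T_def)
  have comp: "compact_space T"
    by (simp add: T_def compact_space_product_topology compact_space_discrete_topology fin)
  define C where "C i = {h \<in> topspace T. P i h}" for i
  have closed: "closedin T (C i)" for i
  proof -
    obtain S where S: "finite S" "\<forall>g h. (\<forall>x\<in>S. g x = h x) \<longrightarrow> P i g \<longrightarrow> P i h"
      using local[of i] by (elim exE conjE) (rule that)
    have "openin T (topspace T - C i)"
    proof (subst openin_subopen, intro ballI)
      fix h assume h: "h \<in> topspace T - C i"
      \<comment> \<open>A basic neighbourhood of \<open>h\<close>: the finitely many coordinates on
        which \<open>P i\<close> depends are frozen and all others are free, so \<open>P i\<close>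
        fails throughout \<open>U\<close>.\<close>
      define U where "U = (\<Pi>\<^sub>E x\<in>UNIV. if x \<in> S then {h x} else D x)"
      have "openin T U"
        unfolding T_def U_def
      proof (rule product_topology_basis)
        show "openin (discrete_topology (D x)) (if x \<in> S then {h x} else D x)" for x
          using h top by simp
        show "finite {x. (if x \<in> S then {h x} else D x) \<noteq> topspace (discrete_topology (D x))}"
          by (rule finite_subset[OF _ S(1)]) auto
      qed
      moreover have "h \<in> U" using h top by (auto simp: U_def)
      moreover have "U \<subseteq> topspace T - C i"
      proof
        fix g assume g: "g \<in> U"
        have eq: "g x = h x" if "x \<in> S" for x
          using PiE_mem[OF g[unfolded U_def], of x] that by simp
        have "\<not> P i g" using S(2)[rule_format, of g h] eq h by (auto simp: C_def)
        moreover have "g \<in> topspace T"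
          using \<open>openin T U\<close> g openin_subset by blast
        ultimately show "g \<in> topspace T - C i" by (simp add: C_def)
      qed
      ultimately show "\<exists>U. openin T U \<and> h \<in> U \<and> U \<subseteq> topspace T - C i" by blast
    qed
    then show ?thesis by (auto simp: closedin_def C_def)
  qed
  have "\<Inter> \<F> \<noteq> {}" if \<F>: "finite \<F>" "\<F> \<subseteq> range C" for \<F>
  proof -
    obtain I where I: "finite I" "\<F> = C ` I"
      using finite_subset_image[OF \<F>] by blast
    obtain h where "\<forall>x. h x \<in> D x" "\<forall>i\<in>I. P i h"
      using sat[OF I(1)] by (elim exE conjE) (rule that)
    then have "h \<in> \<Inter> \<F>" by (simp add: I C_def top)
    then show ?thesis by blast
  qed
  then have "\<forall>\<F>. finite \<F> \<and> \<F> \<subseteq> range C \<longrightarrow> \<Inter> \<F> \<noteq> {}" by simp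
  moreover have "\<forall>K\<in>range C. closedin T K" using closed by simp
  ultimately have "\<Inter> (range C) \<noteq> {}"
    by (intro comp[unfolded compact_space_fip, THEN spec, THEN mp] conjI)
  then obtain h where h: "h \<in> C i" for i by auto
  show ?thesis
  proof (intro exI conjI allI)
    \<comment> \<open>Any index will do here, because every \<open>C i\<close> lies inside the
      product space.\<close>
    show "h x \<in> D x" for x using h[of undefined] by (simp add: C_def top)
    show "P i h" for i using h[of i] by (simp add: C_def)
  qed
qed

section \<open>From elementary equivalence to isomorphism for torsion modules with finite
  annihilators\<close>

theorem elementarily_equivalent_imp_isomorphic:
  fixes act1 :: "'m::ab_group_add \<Rightarrow> 'r::ring_1 \<Rightarrow> 'm"
    and act2 :: "'n::ab_group_add \<Rightarrow> 'r \<Rightarrow> 'n"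
  assumes ee: "elementarily_equivalent act1 act2"
    and module2: "right_module act2"
    and tor1: "torsion act1 = UNIV" and tor2: "torsion act2 = UNIV"
    and fin1: "\<And>r. r \<noteq> 0 \<Longrightarrow> finite {x. act1 x r = 0}"
    and fin2: "\<And>r. r \<noteq> 0 \<Longrightarrow> finite {x. act2 x r = 0}"
  shows "modules_isomorphic act1 act2"
proof -
  interpret M2: right_module act2 by fact
  have act2_zero: "act2 0 r = 0" for r using M2.act_add_left[of 0 0 r] by simp
  have "\<forall>x. \<exists>r. r \<noteq> 0 \<and> act1 x r = 0" using tor1 by (auto simp: torsion_def)
  then obtain ann where ann: "\<And>x. ann x \<noteq> 0" "\<And>x. act1 x (ann x) = 0" by metis
  \<comment> \<open>A triple \<open>(x, y, r)\<close> indexes one instance of additivity, of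
    compatibility with the action and of injectivity. It involves only the elements of
    \<open>support\<close>, and all triples together say that \<open>h\<close> is an injective
    homomorphism.\<close>
  define support :: "'m \<times> 'm \<times> 'r \<Rightarrow> 'm set"
    where "support = (\<lambda>(x, y, r). {x, y, x + y, act1 x r})"
  define P where
    "P i h \<longleftrightarrow> partial_embedding act1 act2 (support i) {snd (snd i)} h" for i and h :: "'m \<Rightarrow> 'n"
  have finite_support: "finite (support i)" for i by (cases i) (simp add: support_def)
  have "\<exists>h. (\<forall>x. h x \<in> {y. act2 y (ann x) = 0}) \<and> (\<forall>i. P i h)"
  proof (rule compactness_finite_domains)
    show "finite {y. act2 y (ann x) = 0}" for x by (rule fin2) (rule ann)
  next
    fix i
    have "\<forall>g h. (\<forall>x\<in>support i. g x = h x) \<longrightarrow> P i g \<longrightarrow> P i h"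
    proof (intro allI impI)
      fix g h assume "\<forall>x\<in>support i. g x = h x" "P i g"
      then show "P i h" unfolding P_def by (subst partial_embedding_cong[of _ h g]) simp_all
    qed
    then show "\<exists>S. finite S \<and> (\<forall>g h. (\<forall>x\<in>S. g x = h x) \<longrightarrow> P i g \<longrightarrow> P i h)"
      using finite_support[of i] by (intro exI[of _ "support i"] conjI)
  next
    fix I :: "('m \<times> 'm \<times> 'r) set" assume "finite I"
    \<comment> \<open>Including 0 in \<open>S\<close> and the chosen annihilators in
      \<open>A\<close> forces a partial embedding to map each \<open>x\<close> in \<open>S\<close>
      to an element killed by \<open>ann x\<close>, hence into its prescribed finite domain.\<close>
    define S where "S = insert 0 (\<Union>i\<in>I. support i)"
    define A where "A = (\<lambda>i. snd (snd i)) ` I \<union> ann ` S"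
    have "finite S" "finite A" using \<open>finite I\<close> by (auto simp: S_def A_def finite_support)
    then obtain h where h: "partial_embedding act1 act2 S A h"
      using ex_partial_embedding[OF ee] by blast
    \<comment> \<open>Outside \<open>S\<close> the map is uncontrolled, so it is reset to 0, which
      lies in every annihilator.\<close>
    define h' where "h' x = (if x \<in> S then h x else 0)" for x
    have h': "partial_embedding act1 act2 S A h'"
      using h by (subst partial_embedding_cong[of _ _ h]) (simp_all add: h'_def)
    have "act2 (h' x) (ann x) = 0" for x
    proof (cases "x \<in> S")
      case True
      then show ?thesis
        using partial_embedding_annihilator[OF h', of x "ann x"] ann by (auto simp: S_def A_def)
    qed (simp add: h'_def act2_zero)
    moreover have "P i h'" if "i \<in> I" for i
      unfolding P_def
      by (rule partial_embedding_mono[OF h']) (use that in \<open>auto simp: S_def A_def\<close>)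
    ultimately show "\<exists>h. (\<forall>x. h x \<in> {y. act2 y (ann x) = 0}) \<and> (\<forall>i\<in>I. P i h)"
      by blast
  qed
  then obtain h where "\<And>i. P i h" by blast
  then have h: "partial_embedding act1 act2 {x, y, x + y, act1 x r} {r} h" for x y r
    using P_def[of "(x, y, r)" h] by (simp add: support_def)
  have add: "h (x + y) = h x + h y" for x y
    using h[of x y] by (auto simp: partial_embedding_def)
  have act: "h (act1 x r) = act2 (h x) r" for x r
    using h[of x _ r] by (auto simp: partial_embedding_def)
  have inj: "inj h"
  proof (rule injI)
    fix x y assume "h x = h y"
    \<comment> \<open>Each local condition contains injectivity on its support, so any triple
      starting with \<open>x\<close> and \<open>y\<close> separates them; the scalar 1 is an
      arbitrary choice.\<close>
    moreover have "inj_on h {x, y, x + y, act1 x 1}"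
      using h[of x y 1] unfolding partial_embedding_def by (rule conjunct1)
    ultimately show "x = y" by (auto dest: inj_onD)
  qed
  have zero: "h 0 = 0" using add[of 0 0] by simp
  have "surj h"
  proof -
    have "z \<in> range h" for z
    proof -
      obtain r where r: "r \<noteq> 0" "act2 z r = 0" using tor2 by (auto simp: torsion_def)
      let ?A1 = "{x. act1 x r = 0}" and ?A2 = "{x. act2 x r = 0}"
      have sub: "h ` ?A1 \<subseteq> ?A2" by (auto simp: zero simp flip: act)
      \<comment> \<open>Elementary equivalence in the reverse direction injects the annihilator
        \<open>?A2\<close> into \<open>?A1\<close>. Since \<open>h\<close> injects
        \<open>?A1\<close> into the finite set \<open>?A2\<close>, counting shows that it is onto
        \<open>?A2\<close>, which contains \<open>z\<close>.\<close>
      have "finite ?A2" by (rule fin2) fact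
      then obtain g where g: "partial_embedding act2 act1 ?A2 {r} g"
        using ex_partial_embedding[OF elementarily_equivalent_sym[OF ee]] by blast
      have "g ` ?A2 \<subseteq> ?A1"
        using partial_embedding_annihilator[OF g] by (auto simp: act2_zero)
      then have "card ?A2 \<le> card ?A1"
        using card_inj_on_le[of g ?A2 ?A1] g fin1[OF r(1)] by (simp add: partial_embedding_def)
      moreover have "card (h ` ?A1) = card ?A1"
        by (rule card_image) (use inj in \<open>auto intro: inj_on_subset\<close>)
      ultimately have "h ` ?A1 = ?A2" using sub \<open>finite ?A2\<close> by (simp add: card_seteq)
      then show ?thesis using r(2) by blast
    qed
    then show ?thesis by auto
  qed
  with inj add act show ?thesis
    by (auto simp: modules_isomorphic_def module_iso_def bij_def)
qed


section \<open>Torsion and algebraicity\<close>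

text \<open>The additive (linearized) polynomial attached to \<open>r\<close>: evaluating it is
  acting by \<open>r\<close>, which makes annihilators into root sets of ordinary
  polynomials.\<close>

definition additive_poly :: "'k::field_prime_char skew_poly \<Rightarrow> 'k poly" where
  "additive_poly r = (\<Sum>i\<le>skew_degree r. monom (skew_coeff r i) (CHAR('k) ^ i))"

lemma CHAR_gt_1: "CHAR('k::field_prime_char) > 1"
  using prime_CHAR_semidom[where 'a='k] CHAR_pos[where 'a='k] prime_gt_1_nat by blast

lemma CHAR_power_inject: "CHAR('k::field_prime_char) ^ i = CHAR('k) ^ j \<longleftrightarrow> i = j"
  using CHAR_gt_1[where 'k='k] by (rule power_inject_exp)

text \<open>The exponents p^i are pairwise distinct, so no cancellation occurs and the leading
  coefficient of \<open>r\<close> survives.\<close>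

lemma additive_poly_nonzero:
  assumes "r \<noteq> 0" shows "additive_poly r \<noteq> 0"
proof -
  let ?n = "skew_degree r"
  have "coeff (additive_poly r) (CHAR('a) ^ ?n) = (\<Sum>i\<le>?n. if i = ?n then skew_coeff r i else 0)"
    by (simp add: additive_poly_def coeff_sum CHAR_power_inject)
  also have "\<dots> = skew_coeff r ?n" by simp
  also have "\<dots> \<noteq> 0" using assms by transfer simp
  finally show ?thesis by auto
qed

section \<open>Transport of polynomials along the embedding\<close>

context field_extension
begin

lemma map_poly_emb_nonzero: "q \<noteq> 0 \<Longrightarrow> map_poly emb q \<noteq> 0"
  by (simp add: map_poly_eq_0_iff)

lemma map_poly_emb_add: "map_poly emb (p + q) = map_poly emb p + map_poly emb q"
  by (rule poly_eqI) (simp add: coeff_map_poly emb_add)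

lemma map_poly_emb_mult: "map_poly emb (p * q) = map_poly emb p * map_poly emb q"
proof -
  have sum: "emb (sum f A) = (\<Sum>i\<in>A. emb (f i))" if "finite A" for f and A :: "nat set"
    using that by induction (simp_all add: emb_add)
  show ?thesis
    by (rule poly_eqI) (simp add: coeff_map_poly coeff_mult emb_mult sum)
qed

lemma map_poly_emb_sum: "finite A \<Longrightarrow> map_poly emb (sum f A) = (\<Sum>i\<in>A. map_poly emb (f i))"
  by (induction rule: finite_induct) (simp_all add: map_poly_emb_add)

end

section \<open>Annihilators as root sets of additive polynomials\<close>

lemma frob_act_eq_poly:
  fixes emb :: "'k::field_prime_char \<Rightarrow> 'f::field_prime_char"
  assumes "field_extension emb"
  shows "frob_act emb x r = poly (map_poly emb (additive_poly r)) x"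
proof -
  interpret field_extension emb by fact
  show ?thesis
    by (simp add: frob_act_def additive_poly_def map_poly_emb_sum map_poly_monom poly_sum poly_monom)
qed

lemma finite_frob_act_annihilator:
  fixes emb :: "'k::field_prime_char \<Rightarrow> 'f::field_prime_char"
  assumes "field_extension emb" and "r \<noteq> 0"
  shows "finite {x. frob_act emb x r = 0}"
proof -
  have "map_poly emb (additive_poly r) \<noteq> 0"
    using assms by (intro field_extension.map_poly_emb_nonzero additive_poly_nonzero)
  then have "finite {x. poly (map_poly emb (additive_poly r)) x = 0}" by (rule poly_roots_finite)
  then show ?thesis unfolding frob_act_eq_poly[OF assms(1)] .
qed

text \<open>Residues modulo \<open>q\<close> live in a space of dimension \<open>degree q\<close>,
  so \<open>degree q + 1\<close> of them satisfy a linear relation.\<close>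

lemma linear_dependence_mod_poly:
  fixes q :: "'k::field poly" and f :: "nat \<Rightarrow> 'k poly"
  assumes "q \<noteq> 0"
  shows "\<exists>c n. (\<exists>i\<le>n. c i \<noteq> 0) \<and> q dvd (\<Sum>i\<le>n. smult (c i) (f i))"
proof -
  interpret vector_space "smult :: 'k \<Rightarrow> 'k poly \<Rightarrow> 'k poly"
    by standard (simp_all add: smult_add_right smult_add_left)
  define n where "n = degree q"
  define g where "g i = f i mod q" for i
  show ?thesis
  \<comment> \<open>Linear dependence is a notion for sets, so it misses repeated residues. A
    repetition is handled separately, where the relation is just the difference of the two equal
    terms.\<close>
  proof (cases "inj_on g {..n}")
    case False
    then obtain i j where ij: "i \<le> n" "j \<le> n" "i \<noteq> j" "g i = g j" by (auto simp: inj_on_def)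
    define c where "c k = (if k = i then 1 else if k = j then -1 else 0 :: 'k)" for k
    have "(\<Sum>k\<le>n. smult (c k) (f k)) = (\<Sum>k\<in>{i, j}. smult (c k) (f k))"
      by (rule sum.mono_neutral_right) (use ij in \<open>auto simp: c_def\<close>)
    also have "\<dots> = f i - f j" using ij(3) by (simp add: c_def)
    finally have "q dvd (\<Sum>k\<le>n. smult (c k) (f k))"
      using ij(4) by (simp add: g_def mod_eq_dvd_iff)
    moreover have "c i \<noteq> 0" by (simp add: c_def)
    ultimately show ?thesis using ij(1) by blast
  next
    case True
    define B where "B = (\<lambda>i. monom (1 :: 'k) i) ` {..<n}"
    have "g i \<in> span B" for i
    proof -
      \<comment> \<open>The alternative \<open>g i = 0\<close> covers constant \<open>q\<close>:
        then \<open>n\<close> is 0 and \<open>B\<close> is empty, although the zero polynomial still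
        has degree 0.\<close>
      have deg: "g i = 0 \<or> degree (g i) < n" unfolding g_def n_def by (rule degree_mod_less) fact
      have "g i = (\<Sum>k\<le>degree (g i). smult (coeff (g i) k) (monom 1 k))"
        by (simp add: smult_monom poly_as_sum_of_monoms)
      also have "\<dots> \<in> span B"
      proof (rule span_sum)
        fix k assume "k \<in> {..degree (g i)}"
        show "smult (coeff (g i) k) (monom 1 k) \<in> span B"
        proof (cases "g i = 0")
          case False
          with deg \<open>k \<in> {..degree (g i)}\<close> have "monom 1 k \<in> B" by (auto simp: B_def)
          then show ?thesis by (intro span_scale span_base)
        qed (simp add: span_zero)
      qed
      finally show ?thesis .
    qed
    then have sub: "g ` {..n} \<subseteq> span B" by blast
    have "finite B" "card B \<le> n" using card_image_le[of "{..<n}"] by (auto simp: B_def)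
    moreover have "card (g ` {..n}) = Suc n" using True by (simp add: card_image)
    ultimately have "dependent (g ` {..n})"
      using independent_span_bound[OF _ _ sub] by fastforce
    then obtain u where u: "\<exists>v\<in>g ` {..n}. u v \<noteq> 0" "(\<Sum>v\<in>g ` {..n}. smult (u v) v) = 0"
      by (auto simp: dependent_finite)
    have "(\<Sum>i\<le>n. smult (u (g i)) (f i)) mod q = (\<Sum>i\<le>n. smult (u (g i)) (g i))"
    proof -
      have "(\<Sum>i\<in>A. smult (d i) (f i)) mod q = (\<Sum>i\<in>A. smult (d i) (g i))" if "finite A" for d A
        using that by induction (simp_all add: poly_mod_add_left mod_smult_left g_def)
      then show ?thesis by simp
    qed
    also have "\<dots> = 0" using u(2) True by (simp add: sum.reindex)
    finally show ?thesis using u(1) by (intro exI[of _ "\<lambda>i. u (g i)"] exI[of _ n]) (auto simp: dvd_eq_mod_eq_0)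
  qed
qed

text \<open>A linear relation modulo \<open>q\<close> among the monomials X^(p^i) is an additive
  polynomial divisible by \<open>q\<close>; its coefficients are those of the required
  \<open>r\<close>.\<close>

lemma ex_additive_poly_multiple:
  fixes q :: "'k::field_prime_char poly"
  assumes "q \<noteq> 0"
  shows "\<exists>r. r \<noteq> 0 \<and> q dvd additive_poly r"
proof -
  obtain c n where c: "\<exists>i\<le>n. c i \<noteq> 0"
    and dvd: "q dvd (\<Sum>i\<le>n. smult (c i) (monom 1 (CHAR('k) ^ i)))"
    using linear_dependence_mod_poly[OF assms, of "\<lambda>i. monom 1 (CHAR('k) ^ i)"] by blast
  define p where "p = (\<Sum>i\<le>n. monom (c i) i)"
  define r where "r = skew_of_poly p"
  have coeff: "coeff p i = (if i \<le> n then c i else 0)" for i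
    by (simp add: p_def coeff_sum)
  have p_r: "poly_of_skew r = p" by (simp add: r_def skew_of_poly_inverse)
  have deg: "degree p \<le> n" by (rule degree_le) (simp add: coeff)
  have "p \<noteq> 0" using c coeff by (metis coeff_0)
  then have "r \<noteq> 0" using p_r by (auto simp: zero_skew_poly.rep_eq)
  moreover have "additive_poly r = (\<Sum>i\<le>degree p. monom (coeff p i) (CHAR('k) ^ i))"
    by (simp add: additive_poly_def skew_degree.rep_eq skew_coeff.rep_eq p_r)
  \<comment> \<open>The top coefficients of the relation may vanish, so \<open>degree p\<close> can
    be smaller than \<open>n\<close>; the extra summands are zero.\<close>
  moreover have "\<dots> = (\<Sum>i\<le>n. monom (coeff p i) (CHAR('k) ^ i))"
    using deg by (intro sum.mono_neutral_left) (auto simp: coeff_eq_0)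
  ultimately show ?thesis using dvd by (auto simp: coeff smult_monom)
qed

text \<open>If \<open>r\<close> kills \<open>x\<close>, then \<open>additive_poly r\<close> is an
  algebraic equation for \<open>x\<close>. Conversely, a root of \<open>q\<close> is a root of every
  multiple of \<open>q\<close>, in particular of an additive one.\<close>

lemma torsion_frob_act:
  fixes emb :: "'k::field_prime_char \<Rightarrow> 'f::field_prime_char"
  assumes "field_extension emb"
  shows "torsion (frob_act emb) = algebraic_closure_in emb"
proof -
  interpret field_extension emb by fact
  have "(\<exists>r. r \<noteq> 0 \<and> frob_act emb x r = 0) \<longleftrightarrow> algebraic_over emb x" for x
  proof
    assume "\<exists>r. r \<noteq> 0 \<and> frob_act emb x r = 0"
    then show "algebraic_over emb x"
      using additive_poly_nonzero by (auto simp: algebraic_over_def frob_act_eq_poly[OF assms])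
  next
    assume "algebraic_over emb x"
    then obtain q where q: "q \<noteq> 0" "poly (map_poly emb q) x = 0" by (auto simp: algebraic_over_def)
    obtain r s where "r \<noteq> 0" "additive_poly r = q * s"
      using ex_additive_poly_multiple[OF q(1)] by (auto simp: dvd_def)
    then show "\<exists>r. r \<noteq> 0 \<and> frob_act emb x r = 0"
      using q(2) by (auto simp: frob_act_eq_poly[OF assms] map_poly_emb_mult)
  qed
  then show ?thesis by (simp add: torsion_def algebraic_closure_in_def)
qed

text \<open>Algebraicity makes both modules torsion by the computation of the torsion submodule, and
  annihilators of non-zero scalars are finite root sets, so the gluing theorem applies.\<close>

lemma algebraic_extension_elementarily_equivalent_iff:
  fixes emb1 :: "'k::field_prime_char \<Rightarrow> 'f1::field_prime_char"
    and emb2 :: "'k \<Rightarrow> 'f2::field_prime_char"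
  assumes "algebraic_extension emb1" "algebraic_extension emb2"
  shows "elementarily_equivalent (frob_act emb1) (frob_act emb2) \<longleftrightarrow>
           modules_isomorphic (frob_act emb1) (frob_act emb2)"
proof
  have ext: "field_extension emb1" "field_extension emb2"
    using assms by (auto simp: algebraic_extension_def)
  have tor: "torsion (frob_act emb1) = UNIV" "torsion (frob_act emb2) = UNIV"
    using assms ext by (auto simp: torsion_frob_act algebraic_extension_def algebraic_closure_in_def)
  assume "elementarily_equivalent (frob_act emb1) (frob_act emb2)"
  then show "modules_isomorphic (frob_act emb1) (frob_act emb2)"
    using frob_act_right_module[OF ext(2)] tor
    by (rule elementarily_equivalent_imp_isomorphic)
      (simp_all add: finite_frob_act_annihilator ext)
qed (rule modules_isomorphic_imp_elementarily_equivalent)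

theorem mainTheorem7:
  shows "(\<forall>emb :: 'k::field_prime_char \<Rightarrow> 'f::field_prime_char.
            field_extension emb \<longrightarrow> torsion (frob_act emb) = algebraic_closure_in emb) \<and>
         (\<forall>(emb1 :: 'k \<Rightarrow> 'f1::field_prime_char) (emb2 :: 'k \<Rightarrow> 'f2::field_prime_char).
            algebraic_extension emb1 \<longrightarrow> algebraic_extension emb2 \<longrightarrow>
            p_closed TYPE('f1) \<longrightarrow> p_closed TYPE('f2) \<longrightarrow>
            (elementarily_equivalent (frob_act emb1) (frob_act emb2) \<longleftrightarrow>
             modules_isomorphic (frob_act emb1) (frob_act emb2)))"
  by (simp add: torsion_frob_act algebraic_extension_elementarily_equivalent_iff)

end
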